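(* Let $G$ be a connected graph of order $n\ge 3$ and size (number of edges) $m$, with minimum degree $\delta$ and maximum degree $\Delta$. Then $$\gamma_{t,coi}(G) \geq \frac{2m+n\delta}{3\Delta+\delta-2}.$$
   Context: All graphs are finite, simple and undirected. A set $D\subseteq V(G)$ is a total dominating set of $G$ if every vertex of $V(G)$ is adjacent to at least one vertex of $D$. A total dominating set $D$ is a total co-independent dominating set (TC-ID set) if $V(G)\setminus D$ is nonempty and independent. The total co-independent domination number $\gamma_{t,coi}(G)$ is the minimum cardinality of a TC-ID set of $G$. *)

theory Defs
  imports Complex_Main "Graph_Theory.Digraph_Component"
begin

text \<open>
  Finite simple undirected graphs are rendered by the locale predicate \<open>graph\<close>: finite loopless
  digraphs without parallel arcs whose adjacency relation is symmetric. Each undirected edge is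
  represented by two opposite arcs, so edges are counted as unordered pairs of end vertices.
\<close>

definition edge_set :: "('a, 'b) pre_digraph \<Rightarrow> 'a set set" where
  "edge_set G = (\<lambda>e. {tail G e, head G e}) ` arcs G"

definition graph_size :: "('a, 'b) pre_digraph \<Rightarrow> nat" where
  "graph_size G = card (edge_set G)"

text \<open>In a \<open>graph\<close> the out-degree of a vertex is the number of its neighbours.\<close>

definition min_degree :: "('a, 'b) pre_digraph \<Rightarrow> nat" where
  "min_degree G = Min (out_degree G ` verts G)"

definition max_degree :: "('a, 'b) pre_digraph \<Rightarrow> nat" where
  "max_degree G = Max (out_degree G ` verts G)"

definition total_dominating :: "('a, 'b) pre_digraph \<Rightarrow> 'a set \<Rightarrow> bool" where
  "total_dominating G D \<longleftrightarrow> D \<subseteq> verts G \<and> (\<forall>v\<in>verts G. \<exists>u\<in>D. v \<rightarrow>\<^bsub>G\<^esub> u)"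

definition independent_verts :: "('a, 'b) pre_digraph \<Rightarrow> 'a set \<Rightarrow> bool" where
  "independent_verts G S \<longleftrightarrow> S \<subseteq> verts G \<and> (\<forall>u\<in>S. \<forall>v\<in>S. \<not> u \<rightarrow>\<^bsub>G\<^esub> v)"

text \<open>Total co-independent dominating (TC-ID) sets.\<close>

definition tcid_set :: "('a, 'b) pre_digraph \<Rightarrow> 'a set \<Rightarrow> bool" where
  "tcid_set G D \<longleftrightarrow>
     total_dominating G D \<and> verts G - D \<noteq> {} \<and> independent_verts G (verts G - D)"

text \<open>
  The minimum is meaningful only if a TC-ID set exists. A connected graph of order at least 3
  has one: all vertices except a single one whose removal leaves the graph connected.
\<close>

definition tcid_number :: "('a, 'b) pre_digraph \<Rightarrow> nat" where
  "tcid_number G = Min (card ` {D. tcid_set G D})"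

end

theory Submission
  imports Defs
begin

text \<open>
  Let \<open>D\<close> be a TC-ID set and \<open>S\<close> its complement. Each vertex of \<open>D\<close> has a neighbour in \<open>D\<close>, so it
  sends at most \<open>\<Delta> - 1\<close> edges to \<open>S\<close>; as \<open>S\<close> is independent, the degrees over \<open>S\<close> add up to at most
  \<open>|D| (\<Delta> - 1)\<close>. Hence \<open>2m \<le> |D| \<Delta> + |D| (\<Delta> - 1)\<close> and \<open>(n - |D|) \<delta> \<le> |D| (\<Delta> - 1)\<close>, and the
  bound is the sum of these two inequalities.
\<close>

lemma (in fin_digraph) sum_out_degree:
  assumes "finite S"
  shows "(\<Sum>v\<in>S. out_degree G v) = card {a \<in> arcs G. tail G a \<in> S}"
proof -
  have "{a \<in> arcs G. tail G a \<in> S} = (\<Union>v\<in>S. out_arcs G v)"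
    by auto
  moreover have "card (\<Union>v\<in>S. out_arcs G v) = (\<Sum>v\<in>S. card (out_arcs G v))"
    using assms by (intro card_UN_disjoint) auto
  ultimately show ?thesis
    by (simp add: out_degree_def)
qed

text \<open>Every edge comes from exactly two arcs: symmetry supplies a reverse arc, looplessness
  makes it different from the original, and the absence of parallel arcs excludes any third.\<close>

lemma (in graph) two_graph_size: "2 * graph_size G = card (arcs G)"
proof -
  let ?ends = "\<lambda>a. {tail G a, head G a}"
  have fiber: "card {a \<in> arcs G. ?ends a = e} = 2" if "e \<in> edge_set G" for e
  proof -
    obtain a where a: "a \<in> arcs G" "e = ?ends a"
      using \<open>e \<in> edge_set G\<close> by (auto simp: edge_set_def)
    obtain b where b: "b \<in> arcs G" "tail G a = head G b" "head G a = tail G b"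
      using a(1) sym_arcs by (auto simp: symmetric_conv)
    have "{x \<in> arcs G. ?ends x = e} = {a, b}"
    proof (intro subset_antisym subsetI)
      fix x assume "x \<in> {x \<in> arcs G. ?ends x = e}"
      then have "x \<in> arcs G"
        and "arc_to_ends G x = arc_to_ends G a \<or> arc_to_ends G x = arc_to_ends G b"
        using a b by (auto simp: arc_to_ends_def doubleton_eq_iff)
      then show "x \<in> {a, b}"
        using a b no_multi_arcs by blast
    qed (use a b in auto)
    moreover have "a \<noteq> b"
      using no_loops[OF a(1)] b by auto
    ultimately show ?thesis
      by simp
  qed
  have "card (arcs G) = (\<Sum>a\<in>arcs G. 1)"
    by simp
  \<comment> \<open>The arcs are grouped by their unordered pair of ends; each group has size 2 by
    \<open>fiber\<close>.\<close>
  also have "\<dots> = (\<Sum>e\<in>edge_set G. card {a \<in> arcs G. ?ends a = e})"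
    unfolding edge_set_def by (subst sum.image_gen[of _ _ ?ends]) simp_all
  also have "\<dots> = 2 * graph_size G"
    by (simp add: fiber graph_size_def)
  finally show ?thesis ..
qed

text \<open>Without parallel arcs, counting arcs is counting pairs of adjacent vertices, and
  swapping coordinates preserves the symmetric adjacency relation.\<close>

lemma (in graph) card_arcs_between_commute:
  "card {a \<in> arcs G. tail G a \<in> S \<and> head G a \<in> T}
    = card {a \<in> arcs G. tail G a \<in> T \<and> head G a \<in> S}"
proof -
  have card_ends: "card {a \<in> arcs G. tail G a \<in> S \<and> head G a \<in> T} = card (arcs_ends G \<inter> S \<times> T)"
    for S T
  proof -
    have "arcs_ends G \<inter> S \<times> T = arc_to_ends G ` {a \<in> arcs G. tail G a \<in> S \<and> head G a \<in> T}"
      by (auto simp: arcs_ends_def arc_to_ends_def)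
    then show ?thesis
      by (simp add: card_image inj_on_subset[OF inj_on_arc_to_ends])
  qed
  have "arcs_ends G \<inter> T \<times> S = prod.swap ` (arcs_ends G \<inter> S \<times> T)"
    by (force intro: graph_symmetric)
  then have "card (arcs_ends G \<inter> T \<times> S) = card (arcs_ends G \<inter> S \<times> T)"
    by (simp add: card_image)
  then show ?thesis
    by (simp add: card_ends)
qed

lemma (in fin_digraph) out_degree_le_max_degree: "v \<in> verts G \<Longrightarrow> out_degree G v \<le> max_degree G"
  by (simp add: max_degree_def)

lemma (in fin_digraph) min_degree_le_out_degree: "v \<in> verts G \<Longrightarrow> min_degree G \<le> out_degree G v"
  by (simp add: min_degree_def)

text \<open>At each vertex of \<open>D\<close> some arc stays inside \<open>D\<close>, so at most
  \<Delta> - 1 arcs leave. The term \<open>card D\<close> stands on the left to avoid truncated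
  subtraction on naturals.\<close>

lemma (in graph) card_arcs_out_of_total_dominating:
  assumes "total_dominating G D"
  shows "card {a \<in> arcs G. tail G a \<in> D \<and> head G a \<notin> D} + card D \<le> card D * max_degree G"
proof -
  have D: "D \<subseteq> verts G" "finite D"
    using assms finite_subset[OF _ finite_verts] by (auto simp: total_dominating_def)
  have outside: "card {a \<in> out_arcs G v. head G a \<notin> D} + 1 \<le> max_degree G" if "v \<in> D" for v
  proof -
    obtain u where "u \<in> D" "v \<rightarrow> u"
      using assms D(1) \<open>v \<in> D\<close> by (auto simp: total_dominating_def)
    obtain a where "a \<in> arcs G" "tail G a = v" "head G a = u"
      using \<open>v \<rightarrow> u\<close> by (rule reachableE)
    then have "a \<in> out_arcs G v - {a \<in> out_arcs G v. head G a \<notin> D}"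
      using \<open>u \<in> D\<close> by simp
    then have "{a \<in> out_arcs G v. head G a \<notin> D} \<subset> out_arcs G v"
      by blast
    then have "card {a \<in> out_arcs G v. head G a \<notin> D} < out_degree G v"
      unfolding out_degree_def by (rule psubset_card_mono[OF finite_out_arcs])
    then show ?thesis
      using out_degree_le_max_degree[of v] D that by auto
  qed
  have "{a \<in> arcs G. tail G a \<in> D \<and> head G a \<notin> D} = (\<Union>v\<in>D. {a \<in> out_arcs G v. head G a \<notin> D})"
    by auto
  moreover have "card (\<Union>v\<in>D. {a \<in> out_arcs G v. head G a \<notin> D})
      \<le> (\<Sum>v\<in>D. card {a \<in> out_arcs G v. head G a \<notin> D})"
    using D by (intro card_UN_le)
  ultimately have "card {a \<in> arcs G. tail G a \<in> D \<and> head G a \<notin> D} + card D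
      \<le> (\<Sum>v\<in>D. card {a \<in> out_arcs G v. head G a \<notin> D} + 1)"
    by (simp add: sum_Suc)
  also have "\<dots> \<le> card D * max_degree G"
    using sum_bounded_above[of D _ "max_degree G"] outside by simp
  finally show ?thesis .
qed

lemma (in graph) tcid_set_bound:
  assumes "tcid_set G D"
  shows "2 * graph_size G + card (verts G) * min_degree G + 2 * card D
    \<le> card D * (3 * max_degree G + min_degree G)"
proof -
  let ?S = "verts G - D"
  have dom: "total_dominating G D" and indep: "independent_verts G ?S"
    using assms by (auto simp: tcid_set_def)
  have D: "D \<subseteq> verts G" "finite D"
    using dom finite_subset[OF _ finite_verts] by (auto simp: total_dominating_def)
  define c where "c = card {a \<in> arcs G. tail G a \<in> D \<and> head G a \<in> ?S}"
  have "{a \<in> arcs G. tail G a \<in> D \<and> head G a \<in> ?S} = {a \<in> arcs G. tail G a \<in> D \<and> head G a \<notin> D}"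
    by auto
  then have c: "c + card D \<le> card D * max_degree G"
    using card_arcs_out_of_total_dominating[OF dom] by (simp add: c_def)
  \<comment> \<open>Independence forces every arc that starts in \<open>?S\<close> to end in
    \<open>D\<close>, so the degrees over \<open>?S\<close> count the arcs from \<open>?S\<close> to
    \<open>D\<close>; by reversal there are \<open>c\<close> of them.\<close>
  have "{a \<in> arcs G. tail G a \<in> ?S} = {a \<in> arcs G. tail G a \<in> ?S \<and> head G a \<in> D}"
    using indep by (fastforce simp: independent_verts_def arcs_ends_conv)
  then have degS: "(\<Sum>v\<in>?S. out_degree G v) = c"
    by (simp only: c_def sum_out_degree finite_Diff finite_verts card_arcs_between_commute[of D])
  have degD: "(\<Sum>v\<in>D. out_degree G v) \<le> card D * max_degree G"
    using sum_bounded_above[of D _ "max_degree G"] out_degree_le_max_degree D by auto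
  have "card ?S * min_degree G \<le> c"
    using sum_bounded_below[of ?S "min_degree G"] min_degree_le_out_degree
    by (auto simp flip: degS)
  moreover have "card (verts G) = card ?S + card D"
    using D by (metis card_Diff_subset card_mono finite_verts le_add_diff_inverse2)
  moreover have "2 * graph_size G = (\<Sum>v\<in>verts G. out_degree G v)"
    using sum_out_degree[of "verts G"] by (simp add: two_graph_size cong: conj_cong)
  then have "2 * graph_size G = c + (\<Sum>v\<in>D. out_degree G v)"
    using D by (simp add: sum.subset_diff[of D "verts G"] degS)
  \<comment> \<open>The bound on \<open>c\<close> enters twice: once through the degree sum over
    \<open>?S\<close> in 2m, once through |S| \<delta> \<le> c. This gives the 2|D| on the left and
    two of the three \<Delta>; the third is \<open>degD\<close>.\<close>
  ultimately show ?thesis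
    using c degD by (simp add: algebra_simps)
qed

text \<open>Symmetry upgrades connectedness to reachability of every vertex from \<open>x\<close>,
  and closure under adjacency carries membership in \<open>A\<close> along each walk.\<close>

lemma (in graph) connected_closed_eq_verts:
  assumes "connected G" and "x \<in> A" and "A \<subseteq> verts G"
    and "\<And>u v. u \<in> A \<Longrightarrow> u \<rightarrow> v \<Longrightarrow> v \<in> A"
  shows "A = verts G"
proof (intro subset_antisym subsetI)
  fix y assume "y \<in> verts G"
  then have "x \<rightarrow>\<^sup>* y"
    using symmetric_connected_imp_strongly_connected[OF sym_arcs \<open>connected G\<close>] assms
    by (auto simp: strongly_connected_def)
  then show "y \<in> A"
    by (induction rule: reachable_induct) (use assms in auto)
qed (use assms in auto)

text \<open>
  The removed vertex is a leaf if there is one, and arbitrary otherwise: either way no vertex has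
  it as its only neighbour.
\<close>

lemma (in graph) tcid_set_exists:
  assumes "connected G" and "card (verts G) \<ge> 3"
  shows "\<exists>D. tcid_set G D"
proof -
  \<comment> \<open>A neighbour-closed set of at most two vertices would be the whole graph, which
    has order at least 3. The case \<open>x = y\<close> is allowed and rules out isolated
    vertices.\<close>
  have no_small: False if "\<And>u v. u \<in> {x, y} \<Longrightarrow> u \<rightarrow> v \<Longrightarrow> v \<in> {x, y}" "{x, y} \<subseteq> verts G" for x y
  proof -
    have "{x, y} = verts G"
      using that by (intro connected_closed_eq_verts[OF assms(1), of x]) auto
    then have "card (verts G) \<le> 2"
      using card_insert_le_m1[of 2 "{y}" x] by simp
    then show False
      using assms by simp
  qed
  have neighbour: "\<exists>w. u \<rightarrow> w" if "u \<in> verts G" for u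
    using no_small[of u u] that by auto
  obtain x where x: "x \<in> verts G" and other: "\<And>u. u \<in> verts G \<Longrightarrow> \<exists>w. w \<noteq> x \<and> u \<rightarrow> w"
  proof (cases "\<exists>x y. x \<in> verts G \<and> (\<forall>v. x \<rightarrow> v \<longrightarrow> v = y)")
    case True
    then obtain x y where x: "x \<in> verts G" and y: "\<And>v. x \<rightarrow> v \<Longrightarrow> v = y"
      by blast
    have "x \<rightarrow> y"
      using neighbour[OF x] y by blast
    then have xy: "{x, y} \<subseteq> verts G"
      by (auto dest: adj_in_verts)
    have "\<exists>w. w \<noteq> x \<and> u \<rightarrow> w" if "u \<in> verts G" for u
    proof (rule ccontr)
      assume "\<not> ?thesis"
      then have only: "\<And>w. u \<rightarrow> w \<Longrightarrow> w = x"
        by blast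
      \<comment> \<open>If the leaf \<open>x\<close> is the only neighbour of \<open>u\<close>, then
        by symmetry \<open>u\<close> is the only neighbour of \<open>x\<close>, and the pair is
        closed under adjacency.\<close>
      then have "u = y"
        using neighbour[OF that] y graph_symmetric by blast
      then show False
        using no_small[of x y] xy only y by blast
    qed
    then show ?thesis
      using that x by blast
  next
    case False
    obtain x where "x \<in> verts G"
      using assms by fastforce
    then show ?thesis
      using that False by blast
  qed
  have "total_dominating G (verts G - {x})"
    using other by (fastforce simp: total_dominating_def dest: adj_in_verts)
  moreover have "independent_verts G (verts G - (verts G - {x}))"
    by (auto simp: independent_verts_def dest: adj_not_same)
  ultimately show ?thesis
    using x by (auto simp: tcid_set_def)
qed

theorem proposition15:
  fixes G :: "('a, 'b) pre_digraph"
  assumes "graph G"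
    and "Digraph_Component.connected G"
    and "card (verts G) \<ge> 3"
  shows "real (tcid_number G) \<ge>
    (2 * real (graph_size G) + real (card (verts G)) * real (min_degree G)) /
    (3 * real (max_degree G) + real (min_degree G) - 2)"
proof -
  interpret graph G by fact
  have "{D. tcid_set G D} \<subseteq> Pow (verts G)"
    by (auto simp: tcid_set_def total_dominating_def)
  then have "finite {D. tcid_set G D}"
    by (rule finite_subset) simp
  \<comment> \<open>Finiteness and existence make the minimum attained; \<open>Min\<close> of an
    empty set would be unspecified.\<close>
  then have "tcid_number G \<in> card ` {D. tcid_set G D}"
    unfolding tcid_number_def using tcid_set_exists assms by (intro Min_in) auto
  then obtain D where D: "tcid_set G D" "tcid_number G = card D"
    by blast
  have "verts G \<noteq> {}"
    using assms by auto
  then obtain v where v: "v \<in> D"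
    using D(1) by (auto simp: tcid_set_def total_dominating_def)
  have "finite D"
    using D(1) finite_subset[OF _ finite_verts] by (auto simp: tcid_set_def total_dominating_def)
  then have "card D > 0"
    using v card_gt_0_iff by blast
  \<comment> \<open>As \<open>D\<close> is nonempty, this yields \<Delta> \<ge> 1, so the
    denominator is at least 3 - 2 = 1 and can be multiplied out.\<close>
  moreover have "card D \<le> card D * max_degree G"
    using D(1) by (intro add_leD2[OF card_arcs_out_of_total_dominating]) (simp add: tcid_set_def)
  ultimately have "max_degree G \<ge> 1"
    by simp
  then have "3 * real (max_degree G) + real (min_degree G) - 2 > 0"
    by linarith
  moreover have "real (2 * graph_size G + card (verts G) * min_degree G + 2 * card D)
      \<le> real (card D * (3 * max_degree G + min_degree G))"
    using tcid_set_bound[OF D(1)] by (simp only: of_nat_le_iff)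
  ultimately show ?thesis
    by (simp add: D(2) pos_divide_le_eq algebra_simps)
qed

end
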